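(* The free boundary problem (P) has a similarity solution of the form $$\theta_1(x,t)=-\frac{D_\infty\operatorname{erf}(\xi)}{\operatorname{erf}(\xi)+\frac{k_1}{h_0\sqrt{\pi\alpha_1}}}\left(1-\frac{\operatorname{erf}\left(\frac{x}{2\sqrt{\alpha_1 t}}\right)}{\operatorname{erf}(\xi)}\right)\quad (0<x<s(t),\ t>0),$$ $$\theta_2(x,t)=\frac{\theta_0\operatorname{erf}(\mu)}{\operatorname{erfc}(\mu)}\left(\frac{\operatorname{erf}\left(\frac{x}{2\sqrt{\alpha_2 t}}\right)}{\operatorname{erf}(\mu)}-1\right)\quad (x>r(t),\ t>0),$$ $$s(t)=2\xi\sqrt{\alpha_1 t},\qquad r(t)=2\mu\sqrt{\alpha_2 t}\quad (t>0),$$ for some $\xi>0$ and with $\mu=\sqrt{\alpha_{12}}\,W(\xi)$, if and only if the coefficient $h_0$ satisfies $$h_0>h_0^\star:=\frac{\gamma k_1}{2D_\infty\,\eta\,\sqrt{\alpha_2}},$$ where $\eta$ is the only solution of the equation $F_3(x)=0$, $x>0$.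
   Context: Parameters: $\rho,k_1,k_2,c_1,c_2,l,\gamma,\theta_0,D_\infty,h_0>0$ and $0<\epsilon<1$ are real constants; $\alpha_i=\frac{k_i}{\rho c_i}$ for $i=1,2$, and $\alpha_{12}=\frac{\alpha_1}{\alpha_2}$. As usual $\operatorname{erf}(x)=\frac{2}{\sqrt\pi}\int_0^x e^{-y^2}\,dy$ and $\operatorname{erfc}=1-\operatorname{erf}$. Problem (P) (two-phase Stefan problem with mushy zone and convective boundary condition): find $\theta_1,\theta_2,s,r$ such that - $\alpha_1\theta_{1,xx}=\theta_{1,t}$ for $0<x<s(t)$, $t>0$; - $\alpha_2\theta_{2,xx}=\theta_{2,t}$ for $x>r(t)$, $t>0$; - $s(0)=r(0)=0$; - $\theta_1(s(t),t)=\theta_2(r(t),t)=0$ for $t>0$; - $\theta_2(x,0)=\theta_2(+\infty,t)=\theta_0$ for $x>0$, $t>0$; - $k_1\theta_{1,x}(s(t),t)-k_2\theta_{2,x}(r(t),t)=\rho l[\epsilon\dot s(t)+(1-\epsilon)\dot r(t)]$ for $t>0$; - $\theta_{1,x}(s(t),t)\,(r(t)-s(t))=\gamma$ for $t>0$; - $k_1\theta_{1,x}(0,t)=\frac{h_0}{\sqrt t}\left(\theta_1(0,t)+D_\infty\right)$ for $t>0$. Values at the boundaries $x=0$, $x=s(t)$, $x=r(t)$, at $t=0$ and at $x=+\infty$ are understood as limits. Auxiliary functions, for $x>0$: $$W(x)=x+\frac{\gamma\sqrt\pi}{2D_\infty}e^{x^2}\left(\operatorname{erf}(x)+\frac{k_1}{h_0\sqrt{\alpha_1\pi}}\right),$$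 $$F_3(x)=\frac{e^{-x^2}}{\operatorname{erfc}(x)}-\frac{\gamma k_1\sqrt\pi}{2\theta_0k_2}\frac1x+\frac{(1-\epsilon)l\sqrt\pi}{\theta_0c_2}\,x.$$ *)

theory Defs
  imports "HOL-Analysis.Analysis"
begin

(* The interval integral is oriented, so this is the usual odd function on all of the reals. *)
definition erf :: "real \<Rightarrow> real" where
  "erf x = 2 / sqrt pi * (LBINT y=ereal 0..ereal x. exp (- (y ^ 2)))"

definition erfc :: "real \<Rightarrow> real" where
  "erfc x = 1 - erf x"

definition dx :: "(real \<Rightarrow> real \<Rightarrow> real) \<Rightarrow> real \<Rightarrow> real \<Rightarrow> real" where
  "dx u x t = deriv (\<lambda>y. u y t) x"

(* The differentiability requirements rule out the arbitrary values that deriv takes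
   at points where the derivative does not exist. *)
definition heat_equation_on ::
  "(real \<times> real) set \<Rightarrow> real \<Rightarrow> (real \<Rightarrow> real \<Rightarrow> real) \<Rightarrow> bool" where
  "heat_equation_on R a u \<longleftrightarrow>
     (\<forall>(x, t)\<in>R.
        (\<lambda>y. u y t) field_differentiable at x \<and>
        (\<lambda>y. dx u y t) field_differentiable at x \<and>
        (\<lambda>\<tau>. u x \<tau>) field_differentiable at t \<and>
        a * deriv (\<lambda>y. dx u y t) x = deriv (\<lambda>\<tau>. u x \<tau>) t)"

(* Phase 1 occupies 0 < x < s t, phase 2 occupies x > r t.  Every value on the boundary of
   a phase is a one-sided limit from inside it (the existence of the limit is part of the
   condition), so values of th1 and th2 outside their phases play no role.
   The condition 0 < s t makes phase 1 nonempty, without which the limits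
   x \<rightarrow> 0+ and x \<rightarrow> s(t)- of th1 would be meaningless. *)
definition stefan_solution ::
  "real \<Rightarrow> real \<Rightarrow> real \<Rightarrow> real \<Rightarrow> real \<Rightarrow> real \<Rightarrow> real \<Rightarrow> real \<Rightarrow> real \<Rightarrow> real \<Rightarrow> real \<Rightarrow>
   (real \<Rightarrow> real \<Rightarrow> real) \<Rightarrow> (real \<Rightarrow> real \<Rightarrow> real) \<Rightarrow> (real \<Rightarrow> real) \<Rightarrow> (real \<Rightarrow> real) \<Rightarrow> bool"
  where
  "stefan_solution \<rho> k1 k2 c1 c2 l \<gamma> \<theta>0 D h0 \<epsilon> th1 th2 s r \<longleftrightarrow>
     (\<forall>t>0. 0 < s t) \<and>
     heat_equation_on {(x, t). 0 < t \<and> 0 < x \<and> x < s t} (k1 / (\<rho> * c1)) th1 \<and>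
     heat_equation_on {(x, t). 0 < t \<and> r t < x} (k2 / (\<rho> * c2)) th2 \<and>
     (s \<longlongrightarrow> 0) (at_right 0) \<and> (r \<longlongrightarrow> 0) (at_right 0) \<and>
     (\<forall>t>0. ((\<lambda>x. th1 x t) \<longlongrightarrow> 0) (at_left (s t)) \<and>
            ((\<lambda>x. th2 x t) \<longlongrightarrow> 0) (at_right (r t))) \<and>
     (\<forall>x>0. ((\<lambda>t. th2 x t) \<longlongrightarrow> \<theta>0) (at_right 0)) \<and>
     (\<forall>t>0. ((\<lambda>x. th2 x t) \<longlongrightarrow> \<theta>0) at_top) \<and>
     (\<forall>t>0. s field_differentiable at t \<and> r field_differentiable at t \<and>
        (\<exists>p q. ((\<lambda>x. dx th1 x t) \<longlongrightarrow> p) (at_left (s t)) \<and>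
               ((\<lambda>x. dx th2 x t) \<longlongrightarrow> q) (at_right (r t)) \<and>
               k1 * p - k2 * q = \<rho> * l * (\<epsilon> * deriv s t + (1 - \<epsilon>) * deriv r t) \<and>
               p * (r t - s t) = \<gamma>)) \<and>
     (\<forall>t>0. \<exists>p v. ((\<lambda>x. dx th1 x t) \<longlongrightarrow> p) (at_right 0) \<and>
                  ((\<lambda>x. th1 x t) \<longlongrightarrow> v) (at_right 0) \<and>
                  k1 * p = h0 / sqrt t * (v + D))"

definition stefan_W ::
  "real \<Rightarrow> real \<Rightarrow> real \<Rightarrow> real \<Rightarrow> real \<Rightarrow> real \<Rightarrow> real" where
  "stefan_W k1 \<alpha>1 \<gamma> D h0 x =
     x + \<gamma> * sqrt pi / (2 * D) * exp (x ^ 2) * (erf x + k1 / (h0 * sqrt (\<alpha>1 * pi)))"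

definition stefan_F3 ::
  "real \<Rightarrow> real \<Rightarrow> real \<Rightarrow> real \<Rightarrow> real \<Rightarrow> real \<Rightarrow> real \<Rightarrow> real \<Rightarrow> real" where
  "stefan_F3 k1 k2 c2 l \<gamma> \<theta>0 \<epsilon> x =
     exp (- (x ^ 2)) / erfc x - \<gamma> * k1 * sqrt pi / (2 * \<theta>0 * k2) * (1 / x)
       + (1 - \<epsilon>) * l * sqrt pi / (\<theta>0 * c2) * x"

end

theory Submission
  imports Defs "HOL-Probability.Distributions" "HOL-Real_Asymp.Real_Asymp"
begin

text \<open>
  Profiles \<open>A + B * erf (x / (2 * sqrt (a * t)))\<close> solve the heat equation, and with the given
  constants and \<open>\<mu> = sqrt \<alpha>12 * W(\<xi>)\<close> every condition of the problem holds automatically except the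
  flux balance on the free boundaries. After multiplication by \<open>sqrt t\<close> the balance no longer
  depends on time: it asks for a zero of a function of \<open>\<xi>\<close>. That function is continuous
  and strictly decreasing, because \<open>exp (- x^2) / erfc x\<close> increases (by the Mills ratio bound), and
  it is eventually negative, so it has a positive zero iff it is positive at \<open>\<xi> = 0\<close>. There it is a
  negative multiple of \<open>F3(\<mu>0)\<close> with \<open>\<mu>0 = \<gamma> * k1 / (2 * D * h0 * sqrt \<alpha>2)\<close>, and since \<open>F3\<close>
  increases, \<open>F3(\<mu>0) < 0\<close> means \<open>\<mu>0 < \<eta>\<close>.
\<close>

subsection \<open>The error function\<close>

lemma has_real_derivative_erf:
  "(erf has_real_derivative 2 / sqrt pi * exp (- (x ^ 2))) (at x)"
proof -
  let ?f = "\<lambda>y::real. exp (- (y ^ 2))"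
  \<comment> \<open>The interval has to contain the base point \<open>0\<close> of the integral and
    to have \<open>x\<close> in its interior, so that the one-sided derivative from the fundamental
    theorem becomes a full one.\<close>
  define a b where "a = min x 0 - 1" and "b = max x 0 + 1"
  have ab: "a < 0" "0 < b" "a < x" "x < b"
    by (auto simp: a_def b_def)
  have "((\<lambda>u. LBINT y=ereal 0..ereal u. ?f y) has_vector_derivative ?f x) (at x within {a..b})"
    using ab by (intro interval_integral_FTC2 continuous_intros) auto
  then have "((\<lambda>u. LBINT y=ereal 0..ereal u. ?f y) has_real_derivative ?f x) (at x)"
    using ab by (simp add: has_real_derivative_iff_has_vector_derivative at_within_Icc_at)
  from DERIV_cmult[OF this, of "2 / sqrt pi"] show ?thesis
    unfolding erf_def[abs_def] by (simp add: mult.commute)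
qed

lemmas has_real_derivative_erf' [derivative_intros] = DERIV_chain2[OF has_real_derivative_erf]

lemma isCont_erf: "isCont erf x"
  by (rule DERIV_isCont[OF has_real_derivative_erf])

lemma continuous_on_erf [continuous_intros]:
  "continuous_on S f \<Longrightarrow> continuous_on S (\<lambda>x. erf (f x))"
  by (rule continuous_on_compose2[of UNIV erf, OF continuous_at_imp_continuous_on])
     (simp_all add: isCont_erf)

lemma erf_0 [simp]: "erf 0 = 0"
  by (simp add: erf_def)

lemma strict_mono_erf: "strict_mono erf"
proof (rule strict_monoI)
  fix x y :: real
  assume "x < y"
  have "\<exists>d. DERIV erf z :> d \<and> 0 < d" for z
    using has_real_derivative_erf[of z] by force
  with \<open>x < y\<close> show "erf x < erf y"
    by (rule DERIV_pos_imp_increasing)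
qed

text \<open>The half-line Gaussian integral is \<open>sqrt pi / 2\<close>, and for
  \<open>y >= 0\<close> the integral in \<open>erf y\<close> is its truncation at
  \<open>y\<close>.\<close>

lemma tendsto_erf_at_top: "(erf \<longlongrightarrow> 1) at_top"
proof -
  let ?g = "\<lambda>x::real. indicator {0..} x *\<^sub>R exp (- x\<^sup>2)"
  have *: "((\<lambda>y. \<integral>x. indicator {..y} x *\<^sub>R ?g x \<partial>lborel) \<longlongrightarrow> sqrt pi / 2) at_top"
    using tendsto_integral_at_top[OF sets_lborel, of ?g] gaussian_moment_0
    unfolding has_bochner_integral_iff by (elim conjE) (simp only:)
  have "eventually (\<lambda>y. 2 / sqrt pi * (\<integral>x. indicator {..y} x *\<^sub>R ?g x \<partial>lborel) = erf y) at_top"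
    using eventually_ge_at_top[of 0]
  proof eventually_elim
    case (elim y)
    have "(LBINT x=ereal 0..ereal y. exp (- (x ^ 2))) = (LBINT x:{0..y}. exp (- (x ^ 2)))"
      using elim by (simp add: interval_integral_Icc)
    also have "\<dots> = (\<integral>x. indicator {..y} x *\<^sub>R ?g x \<partial>lborel)"
      unfolding set_lebesgue_integral_def
      by (intro Bochner_Integration.integral_cong) (auto simp: indicator_def)
    finally show ?case by (simp add: erf_def)
  qed
  moreover have "((\<lambda>y. 2 / sqrt pi * (\<integral>x. indicator {..y} x *\<^sub>R ?g x \<partial>lborel)) \<longlongrightarrow>
      2 / sqrt pi * (sqrt pi / 2)) at_top"
    by (intro tendsto_intros *)
  ultimately show ?thesis
    by (simp add: tendsto_cong)
qed

text \<open>The limit at infinity yields only a weak bound; applying it at \<open>x + 1\<close> and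
  using strict growth from \<open>x\<close> to \<open>x + 1\<close> makes it strict.\<close>

lemma erf_less_1: "erf x < 1"
proof -
  have "erf (x + 1) \<le> 1"
    by (rule tendsto_lowerbound[OF tendsto_erf_at_top])
       (auto intro!: eventually_mono[OF eventually_ge_at_top[of "x + 1"]]
             simp: strict_mono_less_eq[OF strict_mono_erf])
  then show ?thesis
    using strict_monoD[OF strict_mono_erf, of x "x + 1"] by simp
qed

lemma erfc_pos: "0 < erfc x"
  by (simp add: erfc_def erf_less_1)

lemma erf_pos: "0 < x \<Longrightarrow> 0 < erf x"
  using strict_monoD[OF strict_mono_erf, of 0 x] by simp

text \<open>In the derivative of \<open>exp (- (x ^ 2)) / x - sqrt pi * erfc x\<close> the two terms
  \<open>2 * exp (- (x ^ 2))\<close> cancel. What remains is negative, so this difference decreases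
  strictly to its limit 0 and is therefore positive.\<close>

lemma erfc_upper_bound:
  assumes "0 < x"
  shows "sqrt pi * x * erfc x < exp (- (x ^ 2))"
proof -
  define g where "g = (\<lambda>x::real. exp (- (x ^ 2)) / x - sqrt pi * erfc x)"
  have deriv: "(g has_real_derivative - (exp (- (y ^ 2)) / y ^ 2)) (at y)" if "0 < y" for y
    unfolding g_def erfc_def using that
    by (auto intro!: derivative_eq_intros simp: field_simps power2_eq_square)
  have decr: "g z < g y" if "0 < y" "y < z" for y z
  proof (rule DERIV_neg_imp_decreasing[OF \<open>y < z\<close>])
    fix w assume "y \<le> w"
    then show "\<exists>d. DERIV g w :> d \<and> d < 0"
      using \<open>0 < y\<close> deriv[of w] by force
  qed
  have "((\<lambda>x::real. exp (- (x ^ 2)) / x) \<longlongrightarrow> 0) at_top"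
    by real_asymp
  moreover have "(erfc \<longlongrightarrow> 0) at_top"
    using tendsto_diff[OF tendsto_const tendsto_erf_at_top, of 1] by (simp add: erfc_def[abs_def])
  ultimately have "(g \<longlongrightarrow> 0 - sqrt pi * 0) at_top"
    unfolding g_def by (intro tendsto_intros)
  then have lim: "(g \<longlongrightarrow> 0) at_top"
    by simp
  \<comment> \<open>As limits preserve only weak inequalities, \<open>x + 1\<close> is compared with
    the limit first; strictness comes from \<open>x\<close> to \<open>x + 1\<close>.\<close>
  have "\<forall>\<^sub>F y in at_top. g y \<le> g (x + 1)"
    using eventually_gt_at_top[of "x + 1"]
    by eventually_elim (rule less_imp_le, use assms decr[of "x + 1"] in auto)
  with lim have "0 \<le> g (x + 1)"
    by (rule tendsto_upperbound) simp
  with decr[of x "x + 1"] assms have "0 < g x" by simp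
  then show ?thesis
    using assms by (simp add: g_def field_simps)
qed

section \<open>The inverse Mills ratio\<close>

text \<open>Multiplied by \<open>2 / sqrt pi\<close>, this is the hazard rate of the Gaussian tail
  \<open>erfc\<close>. It is the first term of \<open>stefan_F3\<close> and also carries the flux of
  phase 2 at its free boundary.\<close>

definition mills_inverse :: "real \<Rightarrow> real" where
  "mills_inverse x = exp (- (x ^ 2)) / erfc x"

lemma mills_inverse_pos: "0 < mills_inverse x"
  by (simp add: mills_inverse_def erfc_pos)

lemma has_real_derivative_mills_inverse:
  "(mills_inverse has_real_derivative
     2 * exp (- (x ^ 2)) * (exp (- (x ^ 2)) - sqrt pi * x * erfc x) / (sqrt pi * erfc x ^ 2)) (at x)"
  unfolding mills_inverse_def[abs_def] erfc_def using erf_less_1[of x]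
  by (auto intro!: derivative_eq_intros simp: field_simps power2_eq_square)

text \<open>The sign of the derivative is that of
  \<open>exp (- (x ^ 2)) - sqrt pi * x * erfc x\<close>, which \<open>erfc_upper_bound\<close>
  controls for positive arguments.\<close>

lemma strict_mono_on_mills_inverse: "strict_mono_on {0<..} mills_inverse"
proof (rule strict_mono_onI)
  fix x y :: real
  assume "x \<in> {0<..}" "y \<in> {0<..}" "x < y"
  show "mills_inverse x < mills_inverse y"
  proof (rule DERIV_pos_imp_increasing[OF \<open>x < y\<close>])
    fix z assume "x \<le> z"
    with \<open>x \<in> {0<..}\<close> have "0 < z" by simp
    then have "0 < 2 * exp (- (z ^ 2)) * (exp (- (z ^ 2)) - sqrt pi * z * erfc z) / (sqrt pi * erfc z ^ 2)"
      using erfc_upper_bound[of z] erfc_pos[of z] by (intro divide_pos_pos mult_pos_pos) auto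
    then show "\<exists>d. DERIV mills_inverse z :> d \<and> 0 < d"
      using has_real_derivative_mills_inverse by blast
  qed
qed

lemma continuous_on_mills_inverse [continuous_intros]:
  "continuous_on S f \<Longrightarrow> continuous_on S (\<lambda>x. mills_inverse (f x))"
  by (rule continuous_on_compose2[of UNIV mills_inverse, OF continuous_at_imp_continuous_on])
     (simp_all add: DERIV_isCont[OF has_real_derivative_mills_inverse])

subsection \<open>Similarity profiles\<close>

text \<open>For \<open>a, t > 0\<close>, \<open>A\<close> is the value at \<open>x = 0\<close> and
  \<open>A + B\<close> the limit for \<open>x\<close> tending to infinity.\<close>

definition erf_profile :: "real \<Rightarrow> real \<Rightarrow> real \<Rightarrow> real \<Rightarrow> real \<Rightarrow> real" where
  "erf_profile a A B x t = A + B * erf (x / (2 * sqrt (a * t)))"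

definition erf_profile_dx :: "real \<Rightarrow> real \<Rightarrow> real \<Rightarrow> real \<Rightarrow> real" where
  "erf_profile_dx a B x t = B * exp (- (x ^ 2 / (4 * a * t))) / sqrt (pi * (a * t))"

context
  fixes a t :: real
  assumes pos: "0 < a" "0 < t"
begin

lemma DERIV_erf_profile_x:
  "((\<lambda>x. erf_profile a A B x t) has_real_derivative erf_profile_dx a B x t) (at x)"
  unfolding erf_profile_def erf_profile_dx_def using pos
  by (auto intro!: derivative_eq_intros simp: real_sqrt_mult power_divide power_mult_distrib)

lemma dx_erf_profile: "dx (erf_profile a A B) x t = erf_profile_dx a B x t"
  unfolding dx_def by (rule DERIV_imp_deriv[OF DERIV_erf_profile_x])

lemma DERIV_erf_profile_dx_x:
  "((\<lambda>x. erf_profile_dx a B x t) has_real_derivative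
      - x / (2 * a * t) * erf_profile_dx a B x t) (at x)"
  unfolding erf_profile_dx_def using pos
  by (auto intro!: derivative_eq_intros simp: field_simps)

lemma DERIV_erf_profile_t:
  "((\<lambda>t. erf_profile a A B x t) has_real_derivative - x / (2 * t) * erf_profile_dx a B x t) (at t)"
proof -
  have "((\<lambda>t. erf_profile a A B x t) has_real_derivative
      B * (2 / sqrt pi * exp (- ((x / (2 * sqrt (a * t))) ^ 2)) * (- x / (4 * t * sqrt (a * t))))) (at t)"
    unfolding erf_profile_def using pos
    by (auto intro!: derivative_eq_intros simp: field_simps power2_eq_square mult_less_0_iff)
  also have "B * (2 / sqrt pi * exp (- ((x / (2 * sqrt (a * t))) ^ 2)) * (- x / (4 * t * sqrt (a * t))))
    = - x / (2 * t) * erf_profile_dx a B x t"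
    using pos by (simp add: erf_profile_dx_def real_sqrt_mult power_divide power_mult_distrib mult_ac)
  finally show ?thesis .
qed

lemma tendsto_erf_profile: "((\<lambda>x. erf_profile a A B x t) \<longlongrightarrow> erf_profile a A B x t) (at x within S)"
  using DERIV_isCont[OF DERIV_erf_profile_x] isContD tendsto_within_subset by blast

lemma tendsto_erf_profile_dx: "((\<lambda>x. erf_profile_dx a B x t) \<longlongrightarrow> erf_profile_dx a B x t) (at x within S)"
  using DERIV_isCont[OF DERIV_erf_profile_dx_x] isContD tendsto_within_subset by blast

lemma tendsto_erf_profile_at_top: "((\<lambda>x. erf_profile a A B x t) \<longlongrightarrow> A + B) at_top"
proof -
  have "filterlim (\<lambda>x. x / (2 * sqrt (a * t))) at_top at_top"
    using pos filterlim_at_top_mult_tendsto_pos[OF tendsto_const _ filterlim_ident, of "1 / (2 * sqrt (a * t))"]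
    by simp
  from filterlim_compose[OF tendsto_erf_at_top this] show ?thesis
    unfolding erf_profile_def by (auto intro!: tendsto_eq_intros)
qed

text \<open>The similarity variable \<open>x / (2 * sqrt (a * t))\<close> is constantly
  \<open>z\<close> along this parabola, so a Dirichlet condition there constrains only the
  constants.\<close>

lemma erf_profile_free_boundary: "erf_profile a A B (2 * z * sqrt (a * t)) t = A + B * erf z"
  using pos by (simp add: erf_profile_def)

lemma erf_profile_dx_free_boundary:
  "erf_profile_dx a B (2 * z * sqrt (a * t)) t = B * exp (- (z ^ 2)) / sqrt (pi * (a * t))"
  using pos by (simp add: erf_profile_dx_def power_mult_distrib)

lemma erf_profile_0: "erf_profile a A B 0 t = A"
  by (simp add: erf_profile_def)

lemma erf_profile_dx_0: "erf_profile_dx a B 0 t = B / sqrt (pi * (a * t))"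
  by (simp add: erf_profile_dx_def)

lemma DERIV_free_boundary:
  "((\<lambda>t. 2 * z * sqrt (a * t)) has_real_derivative z * sqrt a / sqrt t) (at t)"
  using pos by (auto intro!: derivative_eq_intros simp: field_simps real_sqrt_mult)

end

text \<open>At fixed \<open>x > 0\<close> the similarity variable tends to infinity as
  \<open>t\<close> decreases to 0, so the initial value agrees with the value at infinity.\<close>

lemma tendsto_erf_profile_initial:
  assumes "0 < a" "0 < x"
  shows "((\<lambda>t. erf_profile a A B x t) \<longlongrightarrow> A + B) (at_right 0)"
proof -
  have "filterlim (\<lambda>t. x / (2 * sqrt (a * t))) at_top (at_right 0)"
    using assms by real_asymp
  from filterlim_compose[OF tendsto_erf_at_top this] show ?thesis
    unfolding erf_profile_def by (auto intro!: tendsto_eq_intros)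
qed

lemma tendsto_free_boundary_initial: "((\<lambda>t. 2 * z * sqrt (a * t)) \<longlongrightarrow> 0) (at_right 0)"
  by (rule tendsto_eq_intros refl | simp)+

text \<open>Both sides are multiples of \<open>erf_profile_dx\<close>: the second space derivative
  has factor \<open>- x / (2 * a * t)\<close> and the time derivative
  \<open>- x / (2 * t)\<close>.\<close>

lemma heat_equation_on_erf_profile:
  assumes "0 < a" "\<And>x t. (x, t) \<in> R \<Longrightarrow> 0 < t"
  shows "heat_equation_on R a (erf_profile a A B)"
  unfolding heat_equation_on_def
proof (safe)
  fix x t assume "(x, t) \<in> R"
  then have t: "0 < t" using assms by auto
  note D = DERIV_erf_profile_x[OF \<open>0 < a\<close> t] DERIV_erf_profile_dx_x[OF \<open>0 < a\<close> t]
    DERIV_erf_profile_t[OF \<open>0 < a\<close> t]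
  have dx: "(\<lambda>y. dx (erf_profile a A B) y t) = (\<lambda>y. erf_profile_dx a B y t)"
    using dx_erf_profile[OF \<open>0 < a\<close> t] by auto
  show "(\<lambda>y. erf_profile a A B y t) field_differentiable at x"
    "(\<lambda>y. dx (erf_profile a A B) y t) field_differentiable at x"
    "(\<lambda>\<tau>. erf_profile a A B x \<tau>) field_differentiable at t"
    unfolding field_differentiable_def dx using D by blast+
  show "a * deriv (\<lambda>y. dx (erf_profile a A B) y t) x = deriv (\<lambda>\<tau>. erf_profile a A B x \<tau>) t"
    unfolding dx DERIV_imp_deriv[OF D(2)] DERIV_imp_deriv[OF D(3)]
    using \<open>0 < a\<close> t by (simp add: field_simps)
qed

section \<open>Similarity profiles in the free boundary problem\<close>

lemma dx_cong_open:
  assumes "open S" "x \<in> S" "\<And>y. y \<in> S \<Longrightarrow> u y t = v y t"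
  shows "dx u x t = dx v x t"
  unfolding dx_def using assms by (intro deriv_cong_ev) (auto simp: eventually_nhds)

text \<open>A solution is prescribed only inside its phase, here the open set \<open>S\<close>.
  There its space derivative is that of the profile, and uniqueness of limits along the nontrivial
  filter determines the boundary flux \<open>p\<close>.\<close>

lemma erf_profile_flux_limit:
  assumes "0 < a" "0 < t" "open S" "at (2 * z * sqrt (a * t)) within S \<noteq> bot"
    and "\<And>y. y \<in> S \<Longrightarrow> u y t = erf_profile a A B y t"
    and "((\<lambda>x. dx u x t) \<longlongrightarrow> p) (at (2 * z * sqrt (a * t)) within S)"
  shows "p = B * exp (- (z ^ 2)) / sqrt (pi * (a * t))"
proof -
  let ?F = "at (2 * z * sqrt (a * t)) within S"
  have "dx u x t = erf_profile_dx a B x t" if "x \<in> S" for x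
    using dx_cong_open[where u = u and v = "erf_profile a A B", OF assms(3) that] assms(5)
      dx_erf_profile[OF assms(1,2)] by metis
  then have "\<forall>\<^sub>F x in ?F. dx u x t = erf_profile_dx a B x t"
    by (simp add: eventually_at_filter)
  with assms(6) have lim: "((\<lambda>x. erf_profile_dx a B x t) \<longlongrightarrow> p) ?F"
    by (simp add: tendsto_cong)
  have "p = erf_profile_dx a B (2 * z * sqrt (a * t)) t"
    by (rule tendsto_unique[OF assms(4) lim tendsto_erf_profile_dx[OF assms(1,2)]])
  then show ?thesis
    using erf_profile_dx_free_boundary[OF assms(1,2)] by simp
qed

text \<open>The necessary half: the limits in \<open>stefan_solution\<close> are identified with the
  explicit fluxes of the profiles.\<close>

lemma stefan_solution_flux_balance:
  assumes a: "0 < a1" "0 < a2" "a1 = k1 / (\<rho> * c1)" "a2 = k2 / (\<rho> * c2)"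
    and sol: "stefan_solution \<rho> k1 k2 c1 c2 l \<gamma> \<theta>0 D h0 \<epsilon> th1 th2 s r"
    and "0 < \<xi>"
    and s: "\<And>t. 0 < t \<Longrightarrow> s t = 2 * \<xi> * sqrt (a1 * t)"
    and r: "\<And>t. 0 < t \<Longrightarrow> r t = 2 * \<mu> * sqrt (a2 * t)"
    and th1: "\<And>x t. 0 < t \<Longrightarrow> 0 < x \<Longrightarrow> x < s t \<Longrightarrow> th1 x t = erf_profile a1 A1 B1 x t"
    and th2: "\<And>x t. 0 < t \<Longrightarrow> r t < x \<Longrightarrow> th2 x t = erf_profile a2 A2 B2 x t"
  shows "k1 * (B1 * exp (- (\<xi> ^ 2)) / sqrt (pi * a1)) - k2 * (B2 * exp (- (\<mu> ^ 2)) / sqrt (pi * a2))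
    = \<rho> * l * (\<epsilon> * (\<xi> * sqrt a1) + (1 - \<epsilon>) * (\<mu> * sqrt a2))"
proof -
  have "\<exists>p q. ((\<lambda>x. dx th1 x t) \<longlongrightarrow> p) (at_left (s t)) \<and>
               ((\<lambda>x. dx th2 x t) \<longlongrightarrow> q) (at_right (r t)) \<and>
               k1 * p - k2 * q = \<rho> * l * (\<epsilon> * deriv s t + (1 - \<epsilon>) * deriv r t) \<and>
               p * (r t - s t) = \<gamma>" if "0 < t" for t
    using sol that unfolding stefan_solution_def by simp
  \<comment> \<open>All terms of the balance scale like \<open>1 / sqrt t\<close>, so one instant
    carries the whole information; \<open>t = 1\<close> makes the factor disappear.\<close>
  from this[of 1] obtain p q where
    p: "((\<lambda>x. dx th1 x 1) \<longlongrightarrow> p) (at_left (s 1))" and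
    q: "((\<lambda>x. dx th2 x 1) \<longlongrightarrow> q) (at_right (r 1))" and
    eq: "k1 * p - k2 * q = \<rho> * l * (\<epsilon> * deriv s 1 + (1 - \<epsilon>) * deriv r 1)"
    by auto
  have "0 < s 1"
    using a \<open>0 < \<xi>\<close> by (simp add: s)
  \<comment> \<open>The formula for \<open>th1\<close> is known only between 0 and
    \<open>s 1\<close>, so the left neighbourhood is cut down to that interval.\<close>
  then have S: "at_left (s 1) = at (s 1) within {0<..<s 1}"
    by (intro at_within_nhd[of _ "{0<..}"]) auto
  have "p = B1 * exp (- (\<xi> ^ 2)) / sqrt (pi * (a1 * 1))"
  proof (rule erf_profile_flux_limit[where S = "{0<..<s 1}" and u = th1])
    show "at (2 * \<xi> * sqrt (a1 * 1)) within {0<..<s 1} \<noteq> bot"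
      using S s[of 1] by (metis trivial_limit_at_left_real zero_less_one)
    show "((\<lambda>x. dx th1 x 1) \<longlongrightarrow> p) (at (2 * \<xi> * sqrt (a1 * 1)) within {0<..<s 1})"
      using p S s[of 1] by simp
  qed (use a(1,2) th1 in auto)
  moreover have "q = B2 * exp (- (\<mu> ^ 2)) / sqrt (pi * (a2 * 1))"
  proof (rule erf_profile_flux_limit[where S = "{r 1<..}" and u = th2])
    show "at (2 * \<mu> * sqrt (a2 * 1)) within {r 1<..} \<noteq> bot"
      using r[of 1] by (metis trivial_limit_at_right_real zero_less_one)
    show "((\<lambda>x. dx th2 x 1) \<longlongrightarrow> q) (at (2 * \<mu> * sqrt (a2 * 1)) within {r 1<..})"
      using q r[of 1] by simp
  qed (use a(1,2) th2 in auto)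
  moreover have "deriv f 1 = z * sqrt b" if "0 < b" "\<And>t. 0 < t \<Longrightarrow> f t = 2 * z * sqrt (b * t)"
    for f :: "real \<Rightarrow> real" and z b
  proof -
    have "(f has_real_derivative z * sqrt b / sqrt 1) (at 1)"
      by (rule has_field_derivative_transform_within_open
          [OF DERIV_free_boundary[OF that(1) zero_less_one] open_greaterThan[of 0]])
         (simp_all add: that(2))
    then show ?thesis
      by (simp add: DERIV_imp_deriv)
  qed
  ultimately show ?thesis
    using eq a(1,2) s r by simp
qed

text \<open>The sufficient half: self-similarity removes time from every condition and leaves
  equations between the constants. The third equation in \<open>boundary\<close> serves both the
  initial value and the value at infinity.\<close>

lemma stefan_solution_erf_profile:
  fixes \<rho> :: real
  assumes a: "0 < a1" "0 < a2" "a1 = k1 / (\<rho> * c1)" "a2 = k2 / (\<rho> * c2)"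
    and "0 < \<xi>" "0 < \<mu>"
    and boundary: "A1 + B1 * erf \<xi> = 0" "A2 + B2 * erf \<mu> = 0" "A2 + B2 = \<theta>0"
    and balance: "k1 * (B1 * exp (- (\<xi> ^ 2)) / sqrt (pi * a1))
        - k2 * (B2 * exp (- (\<mu> ^ 2)) / sqrt (pi * a2))
      = \<rho> * l * (\<epsilon> * (\<xi> * sqrt a1) + (1 - \<epsilon>) * (\<mu> * sqrt a2))"
    and mushy: "B1 * exp (- (\<xi> ^ 2)) / sqrt (pi * a1) * (2 * \<mu> * sqrt a2 - 2 * \<xi> * sqrt a1) = \<gamma>"
    and convective: "k1 * B1 / sqrt (pi * a1) = h0 * (A1 + D)"
  shows "stefan_solution \<rho> k1 k2 c1 c2 l \<gamma> \<theta>0 D h0 \<epsilon> (erf_profile a1 A1 B1) (erf_profile a2 A2 B2)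
    (\<lambda>t. 2 * \<xi> * sqrt (a1 * t)) (\<lambda>t. 2 * \<mu> * sqrt (a2 * t))"
    (is "stefan_solution _ _ _ _ _ _ _ _ _ _ _ ?th1 ?th2 ?s ?r")
proof -
  have deriv: "deriv ?s t = \<xi> * sqrt a1 / sqrt t" "deriv ?r t = \<mu> * sqrt a2 / sqrt t" if "0 < t" for t
    by (rule DERIV_imp_deriv[OF DERIV_free_boundary[OF a(1) that]],
        rule DERIV_imp_deriv[OF DERIV_free_boundary[OF a(2) that]])
  have lim: "((\<lambda>x. dx (erf_profile b A B) x t) \<longlongrightarrow> erf_profile_dx b B x t) (at x within S)"
    if "0 < b" "0 < t" for b A B t x S
    using tendsto_erf_profile_dx[OF that] by (simp add: dx_erf_profile[OF that])
  have "\<exists>p q. ((\<lambda>x. dx ?th1 x t) \<longlongrightarrow> p) (at_left (?s t)) \<and>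
               ((\<lambda>x. dx ?th2 x t) \<longlongrightarrow> q) (at_right (?r t)) \<and>
               k1 * p - k2 * q = \<rho> * l * (\<epsilon> * deriv ?s t + (1 - \<epsilon>) * deriv ?r t) \<and>
               p * (?r t - ?s t) = \<gamma>" if "0 < t" for t
  proof (intro exI conjI)
    define p q where
      "p = B1 * exp (- (\<xi> ^ 2)) / sqrt (pi * a1)" and "q = B2 * exp (- (\<mu> ^ 2)) / sqrt (pi * a2)"
    have p: "erf_profile_dx a1 B1 (?s t) t = p / sqrt t"
      and q: "erf_profile_dx a2 B2 (?r t) t = q / sqrt t"
      unfolding erf_profile_dx_free_boundary[OF a(1) that] erf_profile_dx_free_boundary[OF a(2) that]
        p_def q_def by (simp_all add: real_sqrt_mult)
    have "k1 * p - k2 * q = \<rho> * l * (\<epsilon> * (\<xi> * sqrt a1) + (1 - \<epsilon>) * (\<mu> * sqrt a2))"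
      using balance by (simp add: p_def q_def)
    \<comment> \<open>Fluxes and boundary speeds all carry the factor
      \<open>1 / sqrt t\<close>.\<close>
    then have "(k1 * p - k2 * q) / sqrt t
        = \<rho> * l * (\<epsilon> * (\<xi> * sqrt a1) + (1 - \<epsilon>) * (\<mu> * sqrt a2)) / sqrt t"
      by simp
    then show "k1 * erf_profile_dx a1 B1 (?s t) t - k2 * erf_profile_dx a2 B2 (?r t) t
      = \<rho> * l * (\<epsilon> * deriv ?s t + (1 - \<epsilon>) * deriv ?r t)"
      unfolding p q deriv[OF that] by (simp add: algebra_simps diff_divide_distrib add_divide_distrib)
    have "p * (2 * \<mu> * sqrt a2 - 2 * \<xi> * sqrt a1) = \<gamma>"
      using mushy by (simp add: p_def)
    \<comment> \<open>The mushy width grows like \<open>sqrt t\<close> and cancels the decay of the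
      flux.\<close>
    moreover have "p / sqrt t * (?r t - ?s t) = p * (2 * \<mu> * sqrt a2 - 2 * \<xi> * sqrt a1)"
      using that by (simp add: real_sqrt_mult field_simps)
    ultimately show "erf_profile_dx a1 B1 (?s t) t * (?r t - ?s t) = \<gamma>"
      unfolding p by simp
  qed (rule lim[OF a(1) that] lim[OF a(2) that])+
  moreover have "\<exists>p v. ((\<lambda>x. dx ?th1 x t) \<longlongrightarrow> p) (at_right 0) \<and>
      ((\<lambda>x. ?th1 x t) \<longlongrightarrow> v) (at_right 0) \<and> k1 * p = h0 / sqrt t * (v + D)" if "0 < t" for t
  proof (intro exI conjI)
    have "k1 * B1 / sqrt (pi * a1) / sqrt t = h0 * (A1 + D) / sqrt t"
      using convective by simp
    then show "k1 * erf_profile_dx a1 B1 0 t = h0 / sqrt t * (erf_profile a1 A1 B1 0 t + D)"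
      using that a(1,2) by (simp add: erf_profile_dx_0 erf_profile_0 real_sqrt_mult)
  qed (rule lim[OF a(1) that] tendsto_erf_profile[OF a(1) that])+
  moreover have "((\<lambda>x. ?th1 x t) \<longlongrightarrow> 0) (at_left (?s t))" "((\<lambda>x. ?th2 x t) \<longlongrightarrow> 0) (at_right (?r t))"
    if "0 < t" for t
    using tendsto_erf_profile[OF \<open>0 < a1\<close> that, of A1 B1 "?s t"]
      tendsto_erf_profile[OF \<open>0 < a2\<close> that, of A2 B2 "?r t"] that a(1,2) boundary
    by (simp_all add: erf_profile_free_boundary)
  moreover have "?s field_differentiable at t" "?r field_differentiable at t" if "0 < t" for t
    using that a(1,2) DERIV_free_boundary field_differentiable_def by blast+
  moreover have "0 < ?r t" if "0 < t" for t
    using that a(1,2) \<open>0 < \<mu>\<close> by simp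
  ultimately show ?thesis
    unfolding stefan_solution_def
    using \<open>0 < \<xi>\<close> a(1,2) boundary(3) tendsto_erf_profile_initial[of a2 _ A2 B2]
      tendsto_erf_profile_at_top[of a2 _ A2 B2]
    unfolding a(3)[symmetric] a(4)[symmetric]
    by (auto intro!: heat_equation_on_erf_profile tendsto_free_boundary_initial)
qed

subsection \<open>The reduced equation\<close>

text \<open>The intermediate value theorem on \<open>{0..b}\<close> gives the root, which is not 0
  because \<open>0 < f 0\<close>; conversely \<open>f 0\<close> exceeds the value 0 at any positive
  root.\<close>

lemma strict_antimono_root_iff:
  fixes f :: "real \<Rightarrow> real"
  assumes "continuous_on {0..} f" "\<And>x y. 0 \<le> x \<Longrightarrow> x < y \<Longrightarrow> f y < f x" "0 < b" "f b < 0"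
  shows "(\<exists>x>0. f x = 0) \<longleftrightarrow> 0 < f 0"
proof
  assume "0 < f 0"
  moreover have "continuous_on {0..b} f"
    using assms(1) by (rule continuous_on_subset) auto
  ultimately obtain x where "0 \<le> x" "f x = 0"
    using IVT2'[of f b 0 0] assms(3,4) by auto
  with \<open>0 < f 0\<close> show "\<exists>x>0. f x = 0"
    by (intro exI[of _ x]) (auto simp: less_le)
qed (use assms(2)[of 0] in force)

section \<open>The equation for \<eta>\<close>

lemma stefan_F3_eq:
  "stefan_F3 k1 k2 c2 l \<gamma> \<theta>0 \<epsilon> x = mills_inverse x - \<gamma> * k1 * sqrt pi / (2 * \<theta>0 * k2) * (1 / x)
       + (1 - \<epsilon>) * l * sqrt pi / (\<theta>0 * c2) * x"
  by (simp add: stefan_F3_def mills_inverse_def)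

context
  fixes k1 k2 c2 l \<gamma> \<theta>0 \<epsilon> :: real
  assumes pos: "0 < k1" "0 < k2" "0 < c2" "0 < l" "0 < \<gamma>" "0 < \<theta>0" "\<epsilon> < 1"
begin

abbreviation (input) "F3 \<equiv> stefan_F3 k1 k2 c2 l \<gamma> \<theta>0 \<epsilon>"

text \<open>All three summands, including the negative multiple of \<open>1 / x\<close>, increase
  strictly for positive arguments.\<close>

lemma stefan_F3_strict_mono:
  assumes "0 < x" "x < y"
  shows "F3 x < F3 y"
proof -
  have "mills_inverse x < mills_inverse y"
    using strict_mono_onD[OF strict_mono_on_mills_inverse, of x y] assms by simp
  moreover have "\<gamma> * k1 * sqrt pi / (2 * \<theta>0 * k2) * (1 / y) < \<gamma> * k1 * sqrt pi / (2 * \<theta>0 * k2) * (1 / x)"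
    using assms pos by (intro mult_strict_left_mono divide_strict_left_mono) auto
  moreover have "(1 - \<epsilon>) * l * sqrt pi / (\<theta>0 * c2) * x < (1 - \<epsilon>) * l * sqrt pi / (\<theta>0 * c2) * y"
    using assms pos by (intro mult_strict_left_mono) auto
  ultimately show ?thesis
    unfolding stefan_F3_eq by linarith
qed

lemma stefan_F3_root_exists: "\<exists>x>0. F3 x = 0"
proof -
  define A B where "A = \<gamma> * k1 * sqrt pi / (2 * \<theta>0 * k2)" and "B = (1 - \<epsilon>) * l * sqrt pi / (\<theta>0 * c2)"
  have AB: "0 < A" "0 < B"
    using pos by (auto simp: A_def B_def)
  have F3: "F3 x = mills_inverse x - A * (1 / x) + B * x" for x
    by (simp add: stefan_F3_eq A_def B_def)
  \<comment> \<open>The bound \<open>a <= 1\<close> keeps the increasing terms below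
    \<open>mills_inverse 1 + B\<close>, and the second bound makes \<open>A / a\<close> at least
    that large.\<close>
  define a where "a = min 1 (A / (mills_inverse 1 + B))"
  \<comment> \<open>Here \<open>A / b <= A <= B * b\<close>, so the linear term outweighs the
    negative one.\<close>
  define b where "b = max 1 (A / B)"
  have a: "0 < a" "a \<le> 1" and b: "1 \<le> b"
    using AB mills_inverse_pos[of 1] by (auto simp: a_def b_def add_pos_pos)
  have "F3 a \<le> 0"
  proof -
    have "mills_inverse a \<le> mills_inverse 1"
      using a strict_mono_on_imp_mono_on[OF strict_mono_on_mills_inverse] by (auto simp: monotone_on_def)
    moreover have "B * a \<le> B"
      using a AB by simp
    moreover have "mills_inverse 1 + B \<le> A * (1 / a)"
    proof -
      have "a \<le> A / (mills_inverse 1 + B)"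
        by (simp add: a_def)
      then show ?thesis
        using a AB mills_inverse_pos[of 1] by (simp add: field_simps add_pos_pos)
    qed
    ultimately show ?thesis
      unfolding F3 by linarith
  qed
  moreover have "0 \<le> F3 b"
  proof -
    have "A / B \<le> b"
      by (simp add: b_def)
    then have "A / b \<le> A" and "A \<le> B * b"
      using b AB by (simp_all add: field_simps)
    then show ?thesis
      using mills_inverse_pos[of b] by (simp add: F3)
  qed
  moreover have "continuous_on {a..b} F3"
    unfolding stefan_F3_eq using a pos by (auto intro!: continuous_intros)
  ultimately obtain x where "a \<le> x" "F3 x = 0"
    using IVT'[of F3 a 0 b] a b by auto
  with a show ?thesis
    by (intro exI[of _ x]) auto
qed

end

section \<open>The function \<open>stefan_W\<close>\<close>

lemma stefan_W_0:
  assumes "0 < D" "0 < h0" "0 < a1"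
  shows "stefan_W k1 a1 \<gamma> D h0 0 = \<gamma> * k1 / (2 * D * h0 * sqrt a1)"
  using assms by (simp add: stefan_W_def real_sqrt_mult field_simps)

text \<open>Strictness comes from the summand \<open>x\<close>; the remaining product has
  nonnegative, nondecreasing factors on the half-line.\<close>

lemma stefan_W_strict_mono:
  assumes "0 < k1" "0 < a1" "0 < \<gamma>" "0 < D" "0 < h0" "0 \<le> x" "x < y"
  shows "stefan_W k1 a1 \<gamma> D h0 x < stefan_W k1 a1 \<gamma> D h0 y"
proof -
  have "erf x < erf y" "0 \<le> erf x"
    using assms(6,7) strict_monoD[OF strict_mono_erf, of x y] erf_pos[of x] by (cases "x = 0"; force)+
  moreover have "exp (x ^ 2) \<le> exp (y ^ 2)"
    using assms by (simp add: power_mono)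
  moreover have "0 < k1 / (h0 * sqrt (a1 * pi))"
    using assms by simp
  ultimately have "\<gamma> * sqrt pi / (2 * D) * exp (x ^ 2) * (erf x + k1 / (h0 * sqrt (a1 * pi)))
      \<le> \<gamma> * sqrt pi / (2 * D) * exp (y ^ 2) * (erf y + k1 / (h0 * sqrt (a1 * pi)))"
    using assms by (intro mult_mono mult_left_mono) auto
  then show ?thesis
    using \<open>x < y\<close> by (simp add: stefan_W_def)
qed

lemma stefan_W_pos:
  assumes "0 < k1" "0 < a1" "0 < \<gamma>" "0 < D" "0 < h0" "0 \<le> x"
  shows "0 < stefan_W k1 a1 \<gamma> D h0 x"
proof -
  have "0 < stefan_W k1 a1 \<gamma> D h0 0"
    using assms by (simp add: stefan_W_0)
  also have "\<dots> \<le> stefan_W k1 a1 \<gamma> D h0 x"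
    using stefan_W_strict_mono[of k1 a1 \<gamma> D h0 0 x] assms by (cases "x = 0") auto
  finally show ?thesis .
qed

lemma continuous_on_stefan_W [continuous_intros]: "continuous_on S (stefan_W k1 a1 \<gamma> D h0)"
  unfolding stefan_W_def[abs_def] by (intro continuous_intros)

section \<open>Reduction to one equation for \<xi>\<close>

context
  fixes \<rho> k1 k2 c1 c2 l \<gamma> \<theta>0 D h0 \<epsilon> a1 a2 :: real
  assumes pos: "0 < \<rho>" "0 < k1" "0 < k2" "0 < c1" "0 < c2" "0 < l" "0 < \<gamma>" "0 < \<theta>0" "0 < D" "0 < h0"
      "0 < \<epsilon>" "\<epsilon> < 1"
    and a: "a1 = k1 / (\<rho> * c1)" "a2 = k2 / (\<rho> * c2)"
begin

text \<open>This is the \<mu> that belongs to the candidate \<xi> = \<open>z\<close>.\<close>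

abbreviation (input) r_coeff where "r_coeff z \<equiv> sqrt (a1 / a2) * stefan_W k1 a1 \<gamma> D h0 z"

abbreviation (input) robin_erf where "robin_erf z \<equiv> erf z + k1 / (h0 * sqrt (pi * a1))"

text \<open>The flux condition on the free boundaries, after the common factor \<open>1 / sqrt t\<close> has been cancelled.\<close>

definition flux_defect :: "real \<Rightarrow> real" where
  "flux_defect z = k1 * (D / robin_erf z * exp (- (z ^ 2)) / sqrt (pi * a1))
     - k2 * (\<theta>0 / erfc (r_coeff z) * exp (- (r_coeff z ^ 2)) / sqrt (pi * a2))
     - \<rho> * l * (\<epsilon> * (z * sqrt a1) + (1 - \<epsilon>) * (r_coeff z * sqrt a2))"

lemma diffusivities_pos: "0 < a1" "0 < a2"
  using pos by (simp_all add: a)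

lemma robin_erf_pos: "0 \<le> z \<Longrightarrow> 0 < robin_erf z"
  using pos diffusivities_pos erf_pos[of z] by (cases "z = 0") (auto intro!: add_pos_pos)

lemma r_coeff_0: "r_coeff 0 = \<gamma> * k1 / (2 * D * h0 * sqrt a2)"
  using pos diffusivities_pos by (simp add: stefan_W_0 real_sqrt_divide)

lemma r_coeff_pos: "0 \<le> z \<Longrightarrow> 0 < r_coeff z"
  using pos diffusivities_pos by (simp add: stefan_W_pos)

lemma r_coeff_strict_mono: "0 \<le> y \<Longrightarrow> y < z \<Longrightarrow> r_coeff y < r_coeff z"
  using pos diffusivities_pos by (intro mult_strict_left_mono stefan_W_strict_mono) auto

lemma flux_defect_eq:
  "flux_defect z = k1 * D / sqrt (pi * a1) * (exp (- (z ^ 2)) / robin_erf z)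
     - k2 * \<theta>0 / sqrt (pi * a2) * mills_inverse (r_coeff z)
     - \<rho> * l * (\<epsilon> * (z * sqrt a1) + (1 - \<epsilon>) * (r_coeff z * sqrt a2))"
  by (simp add: flux_defect_def mills_inverse_def mult_ac)

text \<open>The flux of phase 1 does not increase, while the two subtracted terms do not decrease;
  strictness is taken from \<open>mills_inverse\<close>.\<close>

lemma flux_defect_strict_antimono:
  assumes "0 \<le> y" "y < z"
  shows "flux_defect z < flux_defect y"
proof -
  have "exp (- (z ^ 2)) / robin_erf z \<le> exp (- (y ^ 2)) / robin_erf y"
  proof (rule frac_le)
    show "robin_erf y \<le> robin_erf z"
      using strict_monoD[OF strict_mono_erf \<open>y < z\<close>] by simp
  qed (use assms robin_erf_pos in \<open>auto simp: power_mono\<close>)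
  then have "k1 * D / sqrt (pi * a1) * (exp (- (z ^ 2)) / robin_erf z)
      \<le> k1 * D / sqrt (pi * a1) * (exp (- (y ^ 2)) / robin_erf y)"
    using pos diffusivities_pos by (intro mult_left_mono) auto
  moreover have "mills_inverse (r_coeff y) < mills_inverse (r_coeff z)"
    using strict_mono_onD[OF strict_mono_on_mills_inverse, of "r_coeff y" "r_coeff z"] assms r_coeff_pos r_coeff_strict_mono
    by simp
  then have "k2 * \<theta>0 / sqrt (pi * a2) * mills_inverse (r_coeff y) < k2 * \<theta>0 / sqrt (pi * a2) * mills_inverse (r_coeff z)"
    using pos diffusivities_pos by (intro mult_strict_left_mono) auto
  moreover have "\<rho> * l * (\<epsilon> * (y * sqrt a1) + (1 - \<epsilon>) * (r_coeff y * sqrt a2))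
      \<le> \<rho> * l * (\<epsilon> * (z * sqrt a1) + (1 - \<epsilon>) * (r_coeff z * sqrt a2))"
    using pos diffusivities_pos assms less_imp_le[OF r_coeff_strict_mono[OF assms]]
    by (intro mult_left_mono add_mono mult_right_mono) auto
  ultimately show ?thesis
    unfolding flux_defect_eq by linarith
qed

lemma flux_defect_eventually_neg: "\<exists>b>0. flux_defect b < 0"
proof -
  \<comment> \<open>\<open>C\<close> bounds the only positive term on the half-line, and
    \<open>b\<close> is chosen so that the latent heat term with \<epsilon> alone equals
    \<open>C\<close>.\<close>
  define C where "C = k1 * D / sqrt (pi * a1) * (1 / robin_erf 0)"
  define b where "b = C / (\<rho> * l * \<epsilon> * sqrt a1)"
  have "0 < b"
    using pos diffusivities_pos by (simp add: b_def C_def)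
  have "exp (- (b ^ 2)) / robin_erf b \<le> 1 / robin_erf 0"
  proof (rule frac_le)
    show "robin_erf 0 \<le> robin_erf b"
      using \<open>0 < b\<close> erf_pos[of b] by simp
  qed (use robin_erf_pos[of 0] in auto)
  then have "k1 * D / sqrt (pi * a1) * (exp (- (b ^ 2)) / robin_erf b) \<le> C"
    unfolding C_def using pos diffusivities_pos by (intro mult_left_mono) auto
  moreover have "\<rho> * l * (\<epsilon> * (b * sqrt a1)) = C"
    using pos diffusivities_pos by (simp add: b_def)
  moreover have "0 < k2 * \<theta>0 / sqrt (pi * a2) * mills_inverse (r_coeff b)"
    using pos diffusivities_pos mills_inverse_pos by simp
  moreover have "0 < \<rho> * l * ((1 - \<epsilon>) * (r_coeff b * sqrt a2))"
    using pos diffusivities_pos r_coeff_pos[OF less_imp_le[OF \<open>0 < b\<close>]]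
    by (intro mult_pos_pos[of "\<rho> * l"] mult_pos_pos[of "1 - \<epsilon>"] mult_pos_pos[of "r_coeff b"]) auto
  ultimately have "flux_defect b < 0"
    unfolding flux_defect_eq distrib_left[of "\<rho> * l"] by linarith
  with \<open>0 < b\<close> show ?thesis by blast
qed

text \<open>At \<open>z = 0\<close> the term with \<epsilon> vanishes, and the remaining three terms
  match those of \<open>stefan_F3\<close> one by one.\<close>

lemma flux_defect_0:
  "flux_defect 0 = - (k2 * \<theta>0 / sqrt (pi * a2)) * stefan_F3 k1 k2 c2 l \<gamma> \<theta>0 \<epsilon> (r_coeff 0)"
proof -
  define m where "m = r_coeff 0"
  have m: "0 < m" "m = \<gamma> * k1 / (2 * D * h0 * sqrt a2)"
    using r_coeff_pos[of 0] r_coeff_0 by (auto simp: m_def)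
  \<comment> \<open>Both sides equal \<open>D * h0\<close>: the value of \<open>m\<close> trades
    these parameters for \<open>1 / m\<close>.\<close>
  have A: "k1 * D / sqrt (pi * a1) * (1 / robin_erf 0)
      = k2 * \<theta>0 / sqrt (pi * a2) * (\<gamma> * k1 * sqrt pi / (2 * \<theta>0 * k2) * (1 / m))"
    unfolding m using pos diffusivities_pos by (simp add: real_sqrt_mult)
  have k2: "k2 = \<rho> * a2 * c2"
    using pos by (simp add: a)
  then have B: "\<rho> * l * ((1 - \<epsilon>) * (m * sqrt a2))
      = k2 * \<theta>0 / sqrt (pi * a2) * ((1 - \<epsilon>) * l * sqrt pi / (\<theta>0 * c2) * m)"
    using pos diffusivities_pos by (subst k2) (simp add: real_sqrt_mult field_simps)
  have "flux_defect 0 = k1 * D / sqrt (pi * a1) * (1 / robin_erf 0)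
      - k2 * \<theta>0 / sqrt (pi * a2) * mills_inverse m - \<rho> * l * ((1 - \<epsilon>) * (m * sqrt a2))"
    by (simp add: flux_defect_eq m_def)
  moreover have "K * X - K * Y - K * Z = - K * (Y - X + Z)" for K X Y Z :: real
    by (simp add: algebra_simps)
  ultimately show ?thesis
    unfolding A B stefan_F3_eq m_def[symmetric] by (simp only:)
qed

lemma flux_defect_root_iff:
  "(\<exists>z>0. flux_defect z = 0) \<longleftrightarrow> stefan_F3 k1 k2 c2 l \<gamma> \<theta>0 \<epsilon> (r_coeff 0) < 0"
proof -
  obtain b where "0 < b" "flux_defect b < 0"
    using flux_defect_eventually_neg by blast
  moreover have "continuous_on {0..} flux_defect"
    unfolding flux_defect_eq[abs_def] using robin_erf_pos diffusivities_pos
    by (auto intro!: continuous_intros simp: less_imp_neq[symmetric])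
  ultimately have "(\<exists>z>0. flux_defect z = 0) \<longleftrightarrow> 0 < flux_defect 0"
    using flux_defect_strict_antimono by (intro strict_antimono_root_iff)
  also have "\<dots> \<longleftrightarrow> stefan_F3 k1 k2 c2 l \<gamma> \<theta>0 \<epsilon> (r_coeff 0) < 0"
  proof -
    have "0 < k2 * \<theta>0 / sqrt (pi * a2)"
      using pos diffusivities_pos by simp
    moreover have "0 < - K * x \<longleftrightarrow> x < 0" if "0 < K" for K x :: real
      using that by (simp add: mult_less_0_iff)
    ultimately show ?thesis
      unfolding flux_defect_0 by blast
  qed
  finally show ?thesis .
qed

text \<open>\<open>stefan_W\<close> is made for this identity: the width compensates the factor
  \<open>exp (- (z ^ 2)) / robin_erf z\<close> of the flux, so the mushy zone condition holds for
  every positive \<open>z\<close>.\<close>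

lemma mushy_width_eq:
  "r_coeff z * sqrt a2 - z * sqrt a1 = sqrt a1 * (\<gamma> * sqrt pi / (2 * D) * exp (z ^ 2) * robin_erf z)"
  using diffusivities_pos by (simp add: stefan_W_def real_sqrt_divide mult.commute[of a1 pi] algebra_simps)

lemma phase1_eq_erf_profile:
  assumes "0 < z"
  shows "- (D * erf z / robin_erf z * (1 - erf (x / (2 * sqrt (a1 * t))) / erf z))
    = erf_profile a1 (- (D * erf z / robin_erf z)) (D / robin_erf z) x t"
  using erf_pos[OF assms] by (simp add: erf_profile_def algebra_simps diff_divide_distrib)

lemma phase2_eq_erf_profile:
  assumes "0 < m"
  shows "\<theta>0 * erf m / erfc m * (erf (x / (2 * sqrt (a2 * t))) / erf m - 1)
    = erf_profile a2 (- (\<theta>0 * erf m / erfc m)) (\<theta>0 / erfc m) x t"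
  using erf_pos[OF assms] by (simp add: erf_profile_def algebra_simps)

lemma flux_defect_zero_if_stefan_solution:
  assumes sol: "stefan_solution \<rho> k1 k2 c1 c2 l \<gamma> \<theta>0 D h0 \<epsilon> th1 th2 s r"
    and "0 < z"
    and sr: "\<forall>t>0. s t = 2 * z * sqrt (a1 * t) \<and> r t = 2 * r_coeff z * sqrt (a2 * t)"
    and th1: "\<forall>t>0. \<forall>x. 0 < x \<and> x < s t \<longrightarrow> th1 x t
      = - (D * erf z / robin_erf z * (1 - erf (x / (2 * sqrt (a1 * t))) / erf z))"
    and th2: "\<forall>t>0. \<forall>x. r t < x \<longrightarrow> th2 x t
      = \<theta>0 * erf (r_coeff z) / erfc (r_coeff z) * (erf (x / (2 * sqrt (a2 * t))) / erf (r_coeff z) - 1)"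
  shows "flux_defect z = 0"
proof -
  note th = th1[unfolded phase1_eq_erf_profile[OF \<open>0 < z\<close>]]
    th2[unfolded phase2_eq_erf_profile[OF r_coeff_pos[OF less_imp_le[OF \<open>0 < z\<close>]]]]
  have "k1 * (D / robin_erf z * exp (- (z ^ 2)) / sqrt (pi * a1))
      - k2 * (\<theta>0 / erfc (r_coeff z) * exp (- (r_coeff z ^ 2)) / sqrt (pi * a2))
    = \<rho> * l * (\<epsilon> * (z * sqrt a1) + (1 - \<epsilon>) * (r_coeff z * sqrt a2))"
    by (rule stefan_solution_flux_balance[OF diffusivities_pos a sol \<open>0 < z\<close>]) (use sr th in blast)+
  then show ?thesis
    by (simp add: flux_defect_def)
qed

lemma stefan_solution_if_flux_defect_zero:
  assumes "0 < z" "flux_defect z = 0"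
  shows "stefan_solution \<rho> k1 k2 c1 c2 l \<gamma> \<theta>0 D h0 \<epsilon>
    (\<lambda>x t. - (D * erf z / robin_erf z * (1 - erf (x / (2 * sqrt (a1 * t))) / erf z)))
    (\<lambda>x t. \<theta>0 * erf (r_coeff z) / erfc (r_coeff z)
      * (erf (x / (2 * sqrt (a2 * t))) / erf (r_coeff z) - 1))
    (\<lambda>t. 2 * z * sqrt (a1 * t)) (\<lambda>t. 2 * r_coeff z * sqrt (a2 * t))"
proof -
  define m F where "m = r_coeff z" and "F = robin_erf z"
  have m: "0 < m" and F: "0 < F" "F = robin_erf z"
    using r_coeff_pos[of z] robin_erf_pos[of z] \<open>0 < z\<close> by (simp_all add: m_def F_def)
  have "stefan_solution \<rho> k1 k2 c1 c2 l \<gamma> \<theta>0 D h0 \<epsilon>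
    (erf_profile a1 (- (D * erf z / F)) (D / F))
    (erf_profile a2 (- (\<theta>0 * erf m / erfc m)) (\<theta>0 / erfc m))
    (\<lambda>t. 2 * z * sqrt (a1 * t)) (\<lambda>t. 2 * m * sqrt (a2 * t))"
  proof (rule stefan_solution_erf_profile[OF diffusivities_pos a \<open>0 < z\<close> m])
    have "- (\<theta>0 * erf m / erfc m) + \<theta>0 / erfc m = \<theta>0 * (1 - erf m) / erfc m"
      by (simp add: diff_divide_distrib algebra_simps)
    then show "- (\<theta>0 * erf m / erfc m) + \<theta>0 / erfc m = \<theta>0"
      using erfc_pos[of m] by (simp add: erfc_def)
    show "k1 * (D / F * exp (- z\<^sup>2) / sqrt (pi * a1)) - k2 * (\<theta>0 / erfc m * exp (- m\<^sup>2) / sqrt (pi * a2))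
      = \<rho> * l * (\<epsilon> * (z * sqrt a1) + (1 - \<epsilon>) * (m * sqrt a2))"
      using assms(2) by (simp add: flux_defect_def m_def F_def)
    have "2 * m * sqrt a2 - 2 * z * sqrt a1 = 2 * (m * sqrt a2 - z * sqrt a1)"
      by simp
    also have "\<dots> = 2 * (sqrt a1 * (\<gamma> * sqrt pi / (2 * D) * exp (z\<^sup>2) * F))"
      by (simp only: mushy_width_eq m_def F_def)
    finally show "D / F * exp (- z\<^sup>2) / sqrt (pi * a1) * (2 * m * sqrt a2 - 2 * z * sqrt a1) = \<gamma>"
      using F(1) pos diffusivities_pos by (simp add: real_sqrt_mult exp_minus field_simps)
    \<comment> \<open>\<open>F - erf z\<close> is the constant
      \<open>k1 / (h0 * sqrt (pi * a1))\<close>, so the convective condition does not restrict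
      \<open>z\<close> either.\<close>
    have "h0 * (- (D * erf z / F) + D) = h0 * D * (F - erf z) / F"
      using F(1) by (simp add: field_simps)
    also have "\<dots> = k1 * (D / F) / sqrt (pi * a1)"
      using F(1) pos by (simp add: F(2) mult_ac)
    finally show "k1 * (D / F) / sqrt (pi * a1) = h0 * (- (D * erf z / F) + D)" ..
  qed simp_all
  then show ?thesis
    unfolding phase1_eq_erf_profile[OF \<open>0 < z\<close>] m_def F_def
      phase2_eq_erf_profile[OF m[unfolded m_def]] .
qed

end

section \<open>The threshold for the convective coefficient\<close>

theorem corollary2p1:
  fixes \<rho> k1 k2 c1 c2 l \<gamma> \<theta>0 D h0 \<epsilon> \<alpha>1 \<alpha>2 \<alpha>12 :: real
  assumes "0 < \<rho>" "0 < k1" "0 < k2" "0 < c1" "0 < c2" "0 < l" "0 < \<gamma>" "0 < \<theta>0" "0 < D" "0 < h0"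
    and "0 < \<epsilon>" "\<epsilon> < 1"
    and "\<alpha>1 = k1 / (\<rho> * c1)" "\<alpha>2 = k2 / (\<rho> * c2)" "\<alpha>12 = \<alpha>1 / \<alpha>2"
  shows "\<exists>\<eta>. (\<forall>x. (0 < x \<and> stefan_F3 k1 k2 c2 l \<gamma> \<theta>0 \<epsilon> x = 0) \<longleftrightarrow> x = \<eta>) \<and>
    ((\<exists>th1 th2 s r \<xi> \<mu>.
        stefan_solution \<rho> k1 k2 c1 c2 l \<gamma> \<theta>0 D h0 \<epsilon> th1 th2 s r \<and>
        0 < \<xi> \<and> \<mu> = sqrt \<alpha>12 * stefan_W k1 \<alpha>1 \<gamma> D h0 \<xi> \<and>
        (\<forall>t>0. s t = 2 * \<xi> * sqrt (\<alpha>1 * t) \<and> r t = 2 * \<mu> * sqrt (\<alpha>2 * t)) \<and>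
        (\<forall>t>0. \<forall>x. 0 < x \<and> x < s t \<longrightarrow>
           th1 x t = - (D * erf \<xi> / (erf \<xi> + k1 / (h0 * sqrt (pi * \<alpha>1)))
                        * (1 - erf (x / (2 * sqrt (\<alpha>1 * t))) / erf \<xi>))) \<and>
        (\<forall>t>0. \<forall>x. r t < x \<longrightarrow>
           th2 x t = \<theta>0 * erf \<mu> / erfc \<mu>
                       * (erf (x / (2 * sqrt (\<alpha>2 * t))) / erf \<mu> - 1)))
     \<longleftrightarrow> h0 > \<gamma> * k1 / (2 * D * \<eta> * sqrt \<alpha>2))"
proof -
  note pos = assms(1-12)
  note params = pos \<open>\<alpha>1 = k1 / (\<rho> * c1)\<close> \<open>\<alpha>2 = k2 / (\<rho> * c2)\<close>
  let ?F3 = "stefan_F3 k1 k2 c2 l \<gamma> \<theta>0 \<epsilon>"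
  let ?\<mu> = "\<lambda>z. sqrt (\<alpha>1 / \<alpha>2) * stefan_W k1 \<alpha>1 \<gamma> D h0 z"
  let ?sol = "\<lambda>th1 th2 s r \<xi> \<mu>.
        stefan_solution \<rho> k1 k2 c1 c2 l \<gamma> \<theta>0 D h0 \<epsilon> th1 th2 s r \<and>
        0 < \<xi> \<and> \<mu> = ?\<mu> \<xi> \<and>
        (\<forall>t>0. s t = 2 * \<xi> * sqrt (\<alpha>1 * t) \<and> r t = 2 * \<mu> * sqrt (\<alpha>2 * t)) \<and>
        (\<forall>t>0. \<forall>x. 0 < x \<and> x < s t \<longrightarrow>
           th1 x t = - (D * erf \<xi> / (erf \<xi> + k1 / (h0 * sqrt (pi * \<alpha>1)))
                        * (1 - erf (x / (2 * sqrt (\<alpha>1 * t))) / erf \<xi>))) \<and>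
        (\<forall>t>0. \<forall>x. r t < x \<longrightarrow>
           th2 x t = \<theta>0 * erf \<mu> / erfc \<mu>
                       * (erf (x / (2 * sqrt (\<alpha>2 * t))) / erf \<mu> - 1))"
  have mono: "?F3 x < ?F3 y" if "0 < x" "x < y" for x y
    using that pos by (intro stefan_F3_strict_mono)
  obtain \<eta> where \<eta>: "0 < \<eta>" "?F3 \<eta> = 0"
    using stefan_F3_root_exists[of k1 k2 c2 l \<gamma> \<theta>0 \<epsilon>] pos by blast
  have unique: "0 < x \<and> ?F3 x = 0 \<longleftrightarrow> x = \<eta>" for x
    using mono[of x \<eta>] mono[of \<eta> x] \<eta> by (cases x \<eta> rule: linorder_cases) auto
  have "(\<exists>th1 th2 s r \<xi> \<mu>. ?sol th1 th2 s r \<xi> \<mu>)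
      \<longleftrightarrow> (\<exists>z>0. flux_defect \<rho> k1 k2 l \<gamma> \<theta>0 D h0 \<epsilon> \<alpha>1 \<alpha>2 z = 0)"
  proof
    assume "\<exists>th1 th2 s r \<xi> \<mu>. ?sol th1 th2 s r \<xi> \<mu>"
    then obtain th1 th2 s r \<xi> where "?sol th1 th2 s r \<xi> (?\<mu> \<xi>)"
      by blast
    note sol = this
    then have "0 < \<xi>"
      by blast
    moreover have "flux_defect \<rho> k1 k2 l \<gamma> \<theta>0 D h0 \<epsilon> \<alpha>1 \<alpha>2 \<xi> = 0"
      using sol by (elim conjE) (rule flux_defect_zero_if_stefan_solution[OF params], assumption+)
    ultimately show "\<exists>z>0. flux_defect \<rho> k1 k2 l \<gamma> \<theta>0 D h0 \<epsilon> \<alpha>1 \<alpha>2 z = 0"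
      by blast
  next
    assume "\<exists>z>0. flux_defect \<rho> k1 k2 l \<gamma> \<theta>0 D h0 \<epsilon> \<alpha>1 \<alpha>2 z = 0"
    then obtain z where "0 < z" "flux_defect \<rho> k1 k2 l \<gamma> \<theta>0 D h0 \<epsilon> \<alpha>1 \<alpha>2 z = 0"
      by blast
    from stefan_solution_if_flux_defect_zero[OF params this] \<open>0 < z\<close>
    show "\<exists>th1 th2 s r \<xi> \<mu>. ?sol th1 th2 s r \<xi> \<mu>"
      by (intro exI conjI) (assumption | rule refl allI impI conjI)+
  qed
  also have "\<dots> \<longleftrightarrow> ?F3 (?\<mu> 0) < 0"
    by (rule flux_defect_root_iff[OF params])
  \<comment> \<open>\<open>?F3\<close> increases strictly and vanishes at \<eta>, so its sign at a
    positive point tells on which side of \<eta> the point lies.\<close>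
  also have "\<dots> \<longleftrightarrow> ?\<mu> 0 < \<eta>"
    using mono[of "?\<mu> 0" \<eta>] mono[of \<eta> "?\<mu> 0"] \<eta> r_coeff_pos[OF params order_refl]
    by (cases "?\<mu> 0" \<eta> rule: linorder_cases) auto
  \<comment> \<open>\<open>?\<mu> 0\<close> is inversely proportional to \<open>h0\<close>, so
    solving for \<open>h0\<close> exchanges the places of \<open>h0\<close> and \<eta>.\<close>
  also have "\<dots> \<longleftrightarrow> h0 > \<gamma> * k1 / (2 * D * \<eta> * sqrt \<alpha>2)"
    unfolding r_coeff_0[OF params] using pos \<eta>(1) diffusivities_pos(2)[OF params]
    by (simp add: field_simps)
  finally show ?thesis
    using unique unfolding \<open>\<alpha>12 = \<alpha>1 / \<alpha>2\<close> by (intro exI[of _ \<eta>] conjI allI)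
qed

end
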